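(* Let $X$ be a finite set with $|X|=n\ge1$ and let $\mathcal{A}$ be an antichain of $2^X$. Then $$2|\mathcal{A}|+|\overline{\nabla}(\mathcal{A})|\le 2\binom{n}{\lfloor n/2\rfloor}+\binom{n}{\lfloor n/2\rfloor+1},$$ and this bound is tight (it is attained by some antichain of $2^X$).
   Context: An antichain of $2^X$ is a non-empty family of subsets of $X$ any two of which are incomparable under inclusion. For a family $\mathcal{A}\subseteq 2^X$, its shade is $\nabla(\mathcal{A})=\{B\subseteq X: \exists A\in\mathcal{A},\ A\subseteq B,\ |B|=|A|+1\}$, and $\overline{\nabla}(\mathcal{A})=\min(\nabla(\mathcal{A}))$ is the set of inclusion-minimal elements of $\nabla(\mathcal{A})$. *)

theory Defs
  imports Main
begin

definition antichain_of :: "'a set \<Rightarrow> 'a set set \<Rightarrow> bool" where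
  "antichain_of X \<A> \<longleftrightarrow>
     \<A> \<subseteq> Pow X \<and> \<A> \<noteq> {} \<and> (\<forall>A\<in>\<A>. \<forall>B\<in>\<A>. A \<noteq> B \<longrightarrow> \<not> A \<subseteq> B \<and> \<not> B \<subseteq> A)"

text \<open>The use of \<^const>\<open>card\<close> makes this meaningful for finite \<open>X\<close> only.\<close>

definition shade :: "'a set \<Rightarrow> 'a set set \<Rightarrow> 'a set set" where
  "shade X \<A> = {B. B \<subseteq> X \<and> (\<exists>A\<in>\<A>. A \<subseteq> B \<and> card B = card A + 1)}"

definition minimal_sets :: "'a set set \<Rightarrow> 'a set set" where
  "minimal_sets \<F> = {B \<in> \<F>. \<forall>C\<in>\<F>. C \<subseteq> B \<longrightarrow> C = B}"

definition min_shade :: "'a set \<Rightarrow> 'a set set \<Rightarrow> 'a set set" where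
  "min_shade X \<A> = minimal_sets (shade X \<A>)"

end

theory Submission
  imports Defs Complex_Main
begin

text \<open>
  No member of the minimal shade \<open>M\<close> lies inside a member of the antichain \<open>A\<close>, so \<open>A\<close> and \<open>M\<close>
  are disjoint antichains. By the LYM inequality the members \<open>F\<close> of \<open>A \<union> M\<close> satisfy
  \<open>\<Sum> 1 / (n choose |F|) \<le> 2\<close>, whence \<open>|A| + |M|\<close> is at most the sum of the two largest binomial
  coefficients (Erdos' extension of Sperner's theorem). Adding Sperner's bound for \<open>|A|\<close> gives
  the claim, and the level \<open>\<lfloor>n/2\<rfloor>\<close> attains it.
\<close>

text \<open>Induction on \<open>card X\<close> by averaging over the deleted point \<open>x\<close>:
  the members of \<open>\<F>\<close> that avoid \<open>x\<close> form an antichain in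
  \<open>X - {x}\<close>, so their weights, taken with \<open>n\<close> in place of
  \<open>Suc n\<close>, sum to at most 1. Summing over all \<open>x\<close> and exchanging the sums
  gives \<open>Suc n\<close> times the claim.\<close>

lemma LYM_inequality:
  assumes "finite X" "\<F> \<subseteq> Pow X" "\<And>A B. A \<in> \<F> \<Longrightarrow> B \<in> \<F> \<Longrightarrow> A \<subseteq> B \<Longrightarrow> A = B"
  shows "(\<Sum>A\<in>\<F>. 1 / real (card X choose card A)) \<le> 1"
  using assms
proof (induction "card X" arbitrary: X \<F>)
  case 0
  then have "\<F> \<subseteq> {{}}" by auto
  then have "\<F> = {} \<or> \<F> = {{}}" by auto
  then show ?case using 0 by auto
next
  case (Suc n)
  show ?case
  \<comment> \<open>The set \<open>X\<close> avoids no point, so the averaging would lose it; but an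
    antichain containing \<open>X\<close> has no other member.\<close>
  proof (cases "X \<in> \<F>")
    case True
    then have "\<F> = {X}" using Suc.prems by blast
    then show ?thesis by simp
  next
    case False
    have fin: "finite \<F>" using Suc.prems by (meson finite_Pow_iff finite_subset)
    have part: "(\<Sum>A | A \<in> \<F> \<and> x \<notin> A. 1 / real (n choose card A)) \<le> 1" if "x \<in> X" for x
    proof -
      have c: "n = card (X - {x})" using Suc.hyps(2) Suc.prems(1) that by simp
      show ?thesis
        unfolding c by (rule Suc.hyps(1)[OF c]) (use Suc.prems in blast)+
    qed
    \<comment> \<open>\<open>A\<close> survives the deletion of exactly
      \<open>Suc n - card A\<close> points. Its weights over these deletions add up to
      \<open>Suc n\<close> times its weight in \<open>X\<close>.\<close>
    have weight: "real (Suc n - card A) * (1 / real (n choose card A))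
        = real (Suc n) * (1 / real (Suc n choose card A))" if "A \<in> \<F>" for A
    proof -
      have "A \<subset> X" using that False Suc.prems by auto
      from psubset_card_mono[OF Suc.prems(1) this]
      have k: "card A \<le> n" using Suc.hyps(2) by simp
      have "(Suc n - card A) * (Suc n choose card A) = Suc n * (n choose card A)"
        using binomial_absorb_comp[of "Suc n" "card A"] by simp
      then have "real (Suc n - card A) * real (Suc n choose card A)
          = real (Suc n) * real (n choose card A)"
        by (metis of_nat_mult)
      moreover have "real (n choose card A) > 0" "real (Suc n choose card A) > 0"
        using k by (simp_all add: zero_less_binomial)
      ultimately show ?thesis by (simp add: frac_eq_eq del: binomial_Suc_Suc)
    qed
    have "real (Suc n) * (\<Sum>A\<in>\<F>. 1 / real (Suc n choose card A))
        = (\<Sum>A\<in>\<F>. \<Sum>x | x \<in> X \<and> x \<notin> A. 1 / real (n choose card A))"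
      unfolding sum_distrib_left
    proof (rule sum.cong[OF refl])
      fix A assume A: "A \<in> \<F>"
      have "{x \<in> X. x \<notin> A} = X - A" by auto
      moreover have "A \<subseteq> X" using A Suc.prems by auto
      ultimately have "card {x \<in> X. x \<notin> A} = Suc n - card A"
        using Suc.hyps(2) Suc.prems(1) by (simp add: card_Diff_subset finite_subset)
      then show "real (Suc n) * (1 / real (Suc n choose card A))
          = (\<Sum>x | x \<in> X \<and> x \<notin> A. 1 / real (n choose card A))"
        using weight[OF A] by simp
    qed
    also have "\<dots> = (\<Sum>x\<in>X. \<Sum>A | A \<in> \<F> \<and> x \<notin> A. 1 / real (n choose card A))"
      by (rule sum.swap_restrict[OF fin Suc.prems(1)])
    also have "\<dots> \<le> (\<Sum>x\<in>X. 1)" by (rule sum_mono) (rule part)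
    also have "\<dots> = real (Suc n)" using Suc.hyps(2) by simp
    finally show ?thesis
      using Suc.hyps(2) by (simp add: mult_le_cancel_left1 del: binomial_Suc_Suc)
  qed
qed

text \<open>Each weight in \<open>LYM_inequality\<close> is at least the reciprocal of the central
  binomial coefficient.\<close>

theorem Sperner:
  assumes "finite X" "\<F> \<subseteq> Pow X" "\<And>A B. A \<in> \<F> \<Longrightarrow> B \<in> \<F> \<Longrightarrow> A \<subseteq> B \<Longrightarrow> A = B"
  shows "card \<F> \<le> card X choose (card X div 2)"
proof -
  let ?c = "real (card X choose (card X div 2))"
  have "real (card \<F>) = (\<Sum>A\<in>\<F>. 1)" by simp
  also have "\<dots> \<le> (\<Sum>A\<in>\<F>. ?c * (1 / real (card X choose card A)))"
  proof (rule sum_mono)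
    fix A assume "A \<in> \<F>"
    then have "card A \<le> card X" using assms by (auto intro: card_mono)
    then have "real (card X choose card A) > 0" by (simp add: zero_less_binomial)
    moreover have "real (card X choose card A) \<le> ?c" by (simp add: binomial_maximum)
    ultimately show "1 \<le> ?c * (1 / real (card X choose card A))" by simp
  qed
  also have "\<dots> \<le> ?c"
    using mult_left_mono[OF LYM_inequality[OF assms], of ?c] by (simp add: sum_distrib_left)
  finally show ?thesis by simp
qed

text \<open>Binomial coefficients decrease from the middle upwards, and a level \<open>k\<close>
  below the middle reflects to \<open>n - k\<close>, which is at least
  \<open>n div 2 + 1\<close>.\<close>

lemma binomial_le_second_largest:
  assumes "k \<le> n" "k \<noteq> n div 2"
  shows "n choose k \<le> n choose (n div 2 + 1)"
proof (cases "k < n div 2")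
  case True
  then have "n choose (n - k) \<le> n choose (n div 2 + 1)" by (intro binomial_antimono) auto
  then show ?thesis using binomial_symmetric[OF assms(1)] by simp
next
  case False
  then show ?thesis using assms by (intro binomial_antimono) auto
qed

text \<open>A linear program: the total weight is at most 2 and level \<open>m\<close> has at most
  \<open>a\<close> sets. These are the cheapest, with weight \<open>1 / a\<close>, and fill weight
  at most 1; any other set costs at least \<open>1 / b\<close>, so the second unit of weight pays
  for at most \<open>b\<close> more.\<close>

theorem Erdos_two_antichains:
  assumes X: "finite X"
    and A: "\<A> \<subseteq> Pow X" "\<And>A B. A \<in> \<A> \<Longrightarrow> B \<in> \<A> \<Longrightarrow> A \<subseteq> B \<Longrightarrow> A = B"
    and B: "\<B> \<subseteq> Pow X" "\<And>A B. A \<in> \<B> \<Longrightarrow> B \<in> \<B> \<Longrightarrow> A \<subseteq> B \<Longrightarrow> A = B"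
    and disj: "\<A> \<inter> \<B> = {}"
  shows "card \<A> + card \<B> \<le> (card X choose (card X div 2)) + (card X choose (card X div 2 + 1))"
proof -
  define n m where "n = card X" and "m = n div 2"
  define a b where "a = real (n choose m)" and "b = real (n choose (m + 1))"
  define \<F> where "\<F> = \<A> \<union> \<B>"
  define w where "w = (\<lambda>F :: 'a set. 1 / real (n choose card F))"
  have FX: "\<F> \<subseteq> Pow X" using A B by (auto simp: \<F>_def)
  have fin: "finite \<A>" "finite \<B>" "finite \<F>"
    using A(1) B(1) X by (auto simp: \<F>_def intro: finite_subset[of _ "Pow X"])
  have a: "a > 0" by (simp add: a_def m_def zero_less_binomial)
  have ba: "b \<le> a" by (simp add: a_def b_def m_def binomial_maximum)
  have w2: "sum w \<F> \<le> 2"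
    using LYM_inequality[OF X A] LYM_inequality[OF X B]
    by (simp add: \<F>_def w_def n_def sum.union_disjoint fin disj)
  have middle: "card {F\<in>\<F>. card F = m} \<le> n choose m"
  proof -
    have "card {F\<in>\<F>. card F = m} \<le> card {F. F \<subseteq> X \<and> card F = m}"
      using FX X by (intro card_mono) auto
    then show ?thesis using X by (simp add: n_subsets n_def)
  qed
  \<comment> \<open>The dual solution: multiplier \<open>b\<close> for the bound \<open>w2\<close>
    and \<open>(a - b) / a\<close> for the bound \<open>middle\<close>, the latter nonnegative by
    \<open>ba\<close>. On level \<open>m\<close> equality holds, since there
    \<open>w F = 1 / a\<close>; elsewhere \<open>b * w F\<close> alone is at least 1.\<close>
  have each: "1 \<le> b * w F + (if card F = m then (a - b) / a else 0)" if "F \<in> \<F>" for F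
  proof (cases "card F = m")
    case True
    then show ?thesis using a by (simp add: w_def a_def[symmetric] field_simps)
  next
    case False
    have k: "card F \<le> n" using that FX X by (auto simp: n_def intro: card_mono)
    then have "real (n choose card F) > 0" by (simp add: zero_less_binomial)
    moreover have "real (n choose card F) \<le> b"
      using binomial_le_second_largest[OF k] False by (simp add: b_def m_def)
    ultimately show ?thesis using False by (simp add: w_def)
  qed
  have "real (card \<F>) = (\<Sum>F\<in>\<F>. 1)" by simp
  also have "\<dots> \<le> (\<Sum>F\<in>\<F>. b * w F + (if card F = m then (a - b) / a else 0))"
    by (rule sum_mono) (rule each)
  also have "\<dots> = b * sum w \<F> + real (card {F\<in>\<F>. card F = m}) * ((a - b) / a)"
    by (simp add: sum.distrib sum_distrib_left sum.inter_filter[OF fin(3), symmetric])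
  also have "\<dots> \<le> b * 2 + a * ((a - b) / a)"
    using w2 middle ba a by (intro add_mono mult_left_mono mult_right_mono) (auto simp: a_def b_def)
  also have "\<dots> = a + b" using a by simp
  finally have "real (card \<F>) \<le> a + b" .
  moreover have "card \<F> = card \<A> + card \<B>"
    unfolding \<F>_def by (rule card_Un_disjoint[OF fin(1,2) disj])
  ultimately have "real (card \<A> + card \<B>) \<le> real ((n choose m) + (n choose (m + 1)))"
    by (simp add: a_def b_def)
  then show ?thesis unfolding n_def m_def by linarith
qed

text \<open>Serves the tightness claim. Any set of size \<open>m + 1\<close> has a point to delete,
  so the shade is the whole next level; its members have equal size, so all are minimal.\<close>

lemma min_shade_level:
  assumes "finite X"
  shows "min_shade X {A. A \<subseteq> X \<and> card A = m} = {B. B \<subseteq> X \<and> card B = m + 1}"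
proof -
  have *: "shade X {A. A \<subseteq> X \<and> card A = m} = {B. B \<subseteq> X \<and> card B = m + 1}"
  proof (intro equalityI subsetI)
    fix B assume B: "B \<in> {B. B \<subseteq> X \<and> card B = m + 1}"
    then obtain x where x: "x \<in> B" by fastforce
    have "card (B - {x}) = m" using B x by (simp add: card_Diff_singleton)
    then show "B \<in> shade X {A. A \<subseteq> X \<and> card A = m}"
      unfolding shade_def using B by (intro CollectI conjI bexI[of _ "B - {x}"]) auto
  qed (auto simp: shade_def)
  have "C = B" if "C \<subseteq> B" "B \<subseteq> X" "card C = card B" for B C
    using card_subset_eq[of B C] that assms finite_subset by blast
  then show ?thesis
    by (intro equalityI subsetI) (simp_all add: min_shade_def minimal_sets_def *)
qed

theorem theorem6p8:
  fixes X :: "'a set" and n :: nat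
  assumes "finite X" and "card X = n" and "n \<ge> 1"
  shows "(\<forall>\<A>. antichain_of X \<A> \<longrightarrow>
            2 * card \<A> + card (min_shade X \<A>)
              \<le> 2 * (n choose (n div 2)) + (n choose (n div 2 + 1)))
       \<and> (\<exists>\<A>. antichain_of X \<A> \<and>
            2 * card \<A> + card (min_shade X \<A>)
              = 2 * (n choose (n div 2)) + (n choose (n div 2 + 1)))"
proof (intro conjI allI impI)
  fix \<A> assume "antichain_of X \<A>"
  then have A: "\<A> \<subseteq> Pow X" "\<And>A B. A \<in> \<A> \<Longrightarrow> B \<in> \<A> \<Longrightarrow> A \<subseteq> B \<Longrightarrow> A = B"
    unfolding antichain_of_def by auto
  have M: "min_shade X \<A> \<subseteq> Pow X"
    "\<And>A B. A \<in> min_shade X \<A> \<Longrightarrow> B \<in> min_shade X \<A> \<Longrightarrow> A \<subseteq> B \<Longrightarrow> A = B"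
    unfolding min_shade_def minimal_sets_def shade_def by auto
  \<comment> \<open>The jump in cardinality makes a shade element a proper superset of some member
    of \<open>\<A>\<close>.\<close>
  have "\<A> \<inter> shade X \<A> = {}"
    using A(2) by (fastforce simp: shade_def)
  then have "\<A> \<inter> min_shade X \<A> = {}"
    unfolding min_shade_def minimal_sets_def by auto
  from Erdos_two_antichains[OF assms(1) A M this] Sperner[OF assms(1) A]
  show "2 * card \<A> + card (min_shade X \<A>) \<le> 2 * (n choose (n div 2)) + (n choose (n div 2 + 1))"
    using assms(2) by simp
next
  let ?L = "{A. A \<subseteq> X \<and> card A = n div 2}"
  have "card ?L = n choose (n div 2)" using assms by (simp add: n_subsets)
  \<comment> \<open>An antichain must be non-empty; here this follows because the central binomial
    coefficient is positive.\<close>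
  moreover from this have "?L \<noteq> {}"
    using zero_less_binomial[of "n div 2" n] by (metis card.empty div_le_dividend less_irrefl)
  then have "antichain_of X ?L"
    unfolding antichain_of_def using assms(1)
    by (smt (verit) Pow_iff card_subset_eq finite_subset mem_Collect_eq subsetI)
  moreover have "card (min_shade X ?L) = n choose (n div 2 + 1)"
    using assms n_subsets[of X "n div 2 + 1"] min_shade_level[of X "n div 2"] by simp
  ultimately show "\<exists>\<A>. antichain_of X \<A> \<and>
      2 * card \<A> + card (min_shade X \<A>) = 2 * (n choose (n div 2)) + (n choose (n div 2 + 1))"
    by (intro exI[of _ ?L] conjI) simp_all
qed

end
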